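(* Let $(C,\bar\xi)$ be a versor field in a Myller configuration with alternative frame $R_A=\{P(s);\bar\xi_2,\bar Y,\bar D\}$ and (nowhere) non-zero alternative curvatures $p,q$, and suppose that $q'p-qp'$ is nowhere zero. Then $\bar Y$ satisfies the differential equation $$\bar Y'''+\frac1{\lambda_1}(\lambda_1'-\lambda_2)\bar Y''+\frac1{\lambda_1}(\lambda_3-\lambda_2')\bar Y'+\frac1{\lambda_1}(\lambda_3'-p)\bar Y=0,$$ where $\lambda_1=\frac{q}{q'p-qp'}$, $\lambda_2=\frac1p(1+p'\lambda_1)$ and $\lambda_3=(p^2+q^2)\lambda_1$.
   Context: All data are smooth. Let $C$ be a curve in Euclidean space $E^3$ with arclength parameter $s\in I$ ($I$ an interval) and position vector $\bar r(s)$, let $\bar\xi(s)$ be a unit vector field along $C$ (a versor field $(C,\bar\xi)$), and let $\pi(s)$ be a plane field along $C$ with $\bar\xi(s)\in\pi(s)$. The pair $((C,\bar\xi),(C,\pi))$ is called a Myller configuration $M=M(C,\bar\xi,\pi)$. Put $\bar\xi_1=\bar\xi$, $K_1=\|d\bar\xi/ds\|>0$ (curvature), define $\bar\xi_2$ by $\bar\xi_1'=K_1\bar\xi_2$, and $\bar\xi_3=\bar\xi_1\times\bar\xi_2$. Then $\{\bar\xi_1,\bar\xi_2,\bar\xi_3\}$ is a positively oriented orthonormal frame, the Frenet-type frame $R_F$, and $$\bar\xi_1'=K_1\bar\xi_2,\quad \bar\xi_2'=-K_1\bar\xi_1+K_2\bar\xi_3,\quad \bar\xi_3'=-K_2\bar\xi_2,$$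 which defines the torsion $K_2$. A prime denotes $d/ds$. The alternative frame (AF-frame) is the orthonormal frame $R_A=\{P(s);\bar\xi_2,\bar Y,\bar D\}$ with $\bar Y=\bar\xi_2'/\|\bar\xi_2'\|$ and $\bar D=\bar\xi_2\times\bar Y=\frac{K_2}{\sqrt{K_1^2+K_2^2}}\bar\xi_1+\frac{K_1}{\sqrt{K_1^2+K_2^2}}\bar\xi_3$. It satisfies $\bar\xi_2'=p\bar Y$, $\bar Y'=-p\bar\xi_2+q\bar D$, $\bar D'=-q\bar Y$, where the alternative curvatures are $p=\sqrt{K_1^2+K_2^2}$ and $q=\frac{K_1^2}{K_1^2+K_2^2}\left(\frac{K_2}{K_1}\right)'$. *)

theory Defs
  imports "HOL-Analysis.Analysis"
begin

unbundle cross3_syntax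

text \<open>Derivative with respect to the parameter, taken within the interval \<open>I\<close>: one-sided at an
  endpoint belonging to \<open>I\<close>. Real-valued functions are covered by taking \<open>'a = real\<close>.\<close>

definition deriv_on :: "real set \<Rightarrow> (real \<Rightarrow> 'a::real_normed_vector) \<Rightarrow> real \<Rightarrow> 'a" where
  "deriv_on I f = (\<lambda>s. vector_derivative f (at s within I))"

definition smooth_curve_on :: "real set \<Rightarrow> (real \<Rightarrow> 'a::real_normed_vector) \<Rightarrow> bool" where
  "smooth_curve_on I f \<longleftrightarrow> (\<forall>n. \<forall>s\<in>I. (deriv_on I ^^ n) f differentiable (at s within I))"

definition proper_interval :: "real set \<Rightarrow> bool" where
  "proper_interval I \<longleftrightarrow> is_interval I \<and> (\<exists>a\<in>I. \<exists>b\<in>I. a < b)"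

definition arclength_curve :: "real set \<Rightarrow> (real \<Rightarrow> real^3) \<Rightarrow> bool" where
  "arclength_curve I r \<longleftrightarrow> smooth_curve_on I r \<and> (\<forall>s\<in>I. norm (deriv_on I r s) = 1)"

definition versor_field :: "real set \<Rightarrow> (real \<Rightarrow> real^3) \<Rightarrow> bool" where
  "versor_field I \<xi> \<longleftrightarrow> smooth_curve_on I \<xi> \<and> (\<forall>s\<in>I. norm (\<xi> s) = 1)"

text \<open>A plane at the point \<open>r s\<close> is represented by its 2-dimensional direction space. A smooth plane
  field over an interval is exactly one that admits a smooth unit normal field.\<close>

definition plane_field :: "real set \<Rightarrow> (real \<Rightarrow> (real^3) set) \<Rightarrow> bool" where
  "plane_field I \<pi> \<longleftrightarrow>
     (\<exists>\<nu>. smooth_curve_on I \<nu> \<and> (\<forall>s\<in>I. norm (\<nu> s) = 1 \<and> \<pi> s = {v. \<nu> s \<bullet> v = 0}))"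

definition myller_configuration ::
  "real set \<Rightarrow> (real \<Rightarrow> real^3) \<Rightarrow> (real \<Rightarrow> real^3) \<Rightarrow> (real \<Rightarrow> (real^3) set) \<Rightarrow> bool" where
  "myller_configuration I r \<xi> \<pi> \<longleftrightarrow>
     proper_interval I \<and> arclength_curve I r \<and> versor_field I \<xi> \<and> plane_field I \<pi> \<and>
     (\<forall>s\<in>I. \<xi> s \<in> \<pi> s)"

definition curvature1 :: "real set \<Rightarrow> (real \<Rightarrow> real^3) \<Rightarrow> real \<Rightarrow> real" where
  "curvature1 I \<xi> s = norm (deriv_on I \<xi> s)"

definition frenet2 :: "real set \<Rightarrow> (real \<Rightarrow> real^3) \<Rightarrow> real \<Rightarrow> real^3" where
  "frenet2 I \<xi> s = (1 / curvature1 I \<xi> s) *\<^sub>R deriv_on I \<xi> s"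

definition frenet3 :: "real set \<Rightarrow> (real \<Rightarrow> real^3) \<Rightarrow> real \<Rightarrow> real^3" where
  "frenet3 I \<xi> s = \<xi> s \<times> frenet2 I \<xi> s"

text \<open>The torsion is the coefficient of \<open>\<xi>\<^sub>3\<close> in the expansion of \<open>\<xi>\<^sub>2'\<close> in the orthonormal frame;
  \<open>frenet_equations\<close> below shows that it satisfies the Frenet equations.\<close>

definition curvature2 :: "real set \<Rightarrow> (real \<Rightarrow> real^3) \<Rightarrow> real \<Rightarrow> real" where
  "curvature2 I \<xi> s = deriv_on I (frenet2 I \<xi>) s \<bullet> frenet3 I \<xi> s"

definition af_Y :: "real set \<Rightarrow> (real \<Rightarrow> real^3) \<Rightarrow> real \<Rightarrow> real^3" where
  "af_Y I \<xi> s = (1 / norm (deriv_on I (frenet2 I \<xi>) s)) *\<^sub>R deriv_on I (frenet2 I \<xi>) s"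

definition af_D :: "real set \<Rightarrow> (real \<Rightarrow> real^3) \<Rightarrow> real \<Rightarrow> real^3" where
  "af_D I \<xi> s = frenet2 I \<xi> s \<times> af_Y I \<xi> s"

definition af_p :: "real set \<Rightarrow> (real \<Rightarrow> real^3) \<Rightarrow> real \<Rightarrow> real" where
  "af_p I \<xi> s = sqrt ((curvature1 I \<xi> s)\<^sup>2 + (curvature2 I \<xi> s)\<^sup>2)"

definition af_q :: "real set \<Rightarrow> (real \<Rightarrow> real^3) \<Rightarrow> real \<Rightarrow> real" where
  "af_q I \<xi> s =
     (curvature1 I \<xi> s)\<^sup>2 / ((curvature1 I \<xi> s)\<^sup>2 + (curvature2 I \<xi> s)\<^sup>2) *
     deriv_on I (\<lambda>t. curvature2 I \<xi> t / curvature1 I \<xi> t) s"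

lemma proper_interval_not_bot:
  assumes "proper_interval I" "s \<in> I"
  shows "at s within I \<noteq> bot"
proof -
  obtain a b where ab: "a \<in> I" "b \<in> I" "a < b"
    using assms by (auto simp: proper_interval_def)
  have "connected I"
    using assms by (simp add: proper_interval_def is_interval_connected_1)
  moreover have "I \<noteq> {s}"
    using ab by auto
  ultimately show ?thesis
    using connected_imp_perfect[of I s] assms(2) by (auto simp: trivial_limit_within)
qed

lemma deriv_on_eqI:
  assumes "proper_interval I" "s \<in> I" "(f has_vector_derivative d) (at s within I)"
  shows "deriv_on I f s = d"
  unfolding deriv_on_def
  using proper_interval_not_bot[OF assms(1,2)] assms(3) by (rule vector_derivative_within)

lemma smooth_curve_on_deriv:
  assumes "smooth_curve_on I f" "s \<in> I"
  shows "(f has_vector_derivative deriv_on I f s) (at s within I)"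
    and "(deriv_on I f has_vector_derivative deriv_on I (deriv_on I f) s) (at s within I)"
proof -
  have "(deriv_on I ^^ 0) f differentiable (at s within I)"
    and "(deriv_on I ^^ 1) f differentiable (at s within I)"
    using assms unfolding smooth_curve_on_def by blast+
  then show "(f has_vector_derivative deriv_on I f s) (at s within I)"
    and "(deriv_on I f has_vector_derivative deriv_on I (deriv_on I f) s) (at s within I)"
    by (simp_all add: vector_derivative_works deriv_on_def)
qed

lemma cross3_frame_expansion:
  fixes a b v :: "real^3"
  assumes a: "norm a = 1" and b: "norm b = 1" and ab: "a \<bullet> b = 0"
  shows "v = (v \<bullet> a) *\<^sub>R a + (v \<bullet> b) *\<^sub>R b + (v \<bullet> (a \<times> b)) *\<^sub>R (a \<times> b)"
proof -
  let ?c = "a \<times> b"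
  define w where "w = v - ((v \<bullet> a) *\<^sub>R a + (v \<bullet> b) *\<^sub>R b + (v \<bullet> ?c) *\<^sub>R ?c)"
  have n: "a \<bullet> a = 1" "b \<bullet> b = 1" "b \<bullet> a = 0"
    using a b ab by (auto simp: norm_eq_1 inner_commute)
  have c: "?c \<bullet> ?c = 1" "?c \<bullet> a = 0" "?c \<bullet> b = 0" "a \<bullet> ?c = 0" "b \<bullet> ?c = 0"
    using n ab by (simp_all add: dot_cross dot_cross_self inner_commute[of "a \<times> b"])
  have wa: "w \<bullet> a = 0" and wb: "w \<bullet> b = 0" and wc: "w \<bullet> ?c = 0"
    by (simp_all add: w_def inner_diff_left inner_add_left n c ab)
  have "w \<times> ?c = 0"
    using wa wb by (simp add: Lagrange)
  then have "w = 0"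
    using wc norm_and_cross_eq_0[of w ?c] c(1) by auto
  then show ?thesis
    by (simp add: w_def)
qed

theorem frenet_equations:
  assumes I: "proper_interval I" and xi: "versor_field I \<xi>"
    and K1: "\<forall>s\<in>I. curvature1 I \<xi> s > 0" and s: "s \<in> I"
  shows "deriv_on I \<xi> s = curvature1 I \<xi> s *\<^sub>R frenet2 I \<xi> s"
    and "deriv_on I (frenet2 I \<xi>) s =
           - curvature1 I \<xi> s *\<^sub>R \<xi> s + curvature2 I \<xi> s *\<^sub>R frenet3 I \<xi> s"
    and "deriv_on I (frenet3 I \<xi>) s = - curvature2 I \<xi> s *\<^sub>R frenet2 I \<xi> s"
proof -
  let ?e2 = "frenet2 I \<xi>" and ?e3 = "frenet3 I \<xi>" and ?K1 = "curvature1 I \<xi>"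
  have nb: "at s within I \<noteq> bot"
    using proper_interval_not_bot[OF I s] .
  have const: "f s \<bullet> g' + f' \<bullet> g s = 0"
    if "(f has_vector_derivative f') (at s within I)" "(g has_vector_derivative g') (at s within I)"
      and c: "\<And>t. t \<in> I \<Longrightarrow> f t \<bullet> g t = c" for f g :: "real \<Rightarrow> real^3" and f' g' c
  proof -
    have "((\<lambda>t. f t \<bullet> g t) has_vector_derivative f s \<bullet> g' + f' \<bullet> g s) (at s within I)"
      by (rule bounded_bilinear.has_vector_derivative[OF bounded_bilinear_inner that(1,2)])
    moreover have "((\<lambda>t. f t \<bullet> g t) has_vector_derivative 0) (at s within I)"
      by (rule has_vector_derivative_transform[OF s _ has_vector_derivative_const[of c]])
         (simp add: c)
    ultimately show ?thesis
      using vector_derivative_unique_within[OF nb] by blast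
  qed
  have sm: "smooth_curve_on I \<xi>"
    using xi by (simp add: versor_field_def)
  have unit1: "norm (\<xi> t) = 1" if "t \<in> I" for t
    using xi that by (simp add: versor_field_def)
  note d1 = smooth_curve_on_deriv[OF sm s]
  have xi': "deriv_on I \<xi> t = ?K1 t *\<^sub>R ?e2 t" if "t \<in> I" for t
    using K1 that by (simp add: frenet2_def less_imp_neq[symmetric])
  then show "deriv_on I \<xi> s = ?K1 s *\<^sub>R ?e2 s"
    using s by blast
  have unit2: "norm (?e2 t) = 1" if "t \<in> I" for t
    using K1 that by (auto simp: frenet2_def curvature1_def)
  have orth: "\<xi> t \<bullet> ?e2 t = 0" if t: "t \<in> I" for t
  proof -
    have nbt: "at t within I \<noteq> bot"
      using proper_interval_not_bot[OF I t] .
    have "((\<lambda>t. \<xi> t \<bullet> \<xi> t) has_vector_derivative \<xi> t \<bullet> deriv_on I \<xi> t + deriv_on I \<xi> t \<bullet> \<xi> t)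
            (at t within I)"
      by (intro bounded_bilinear.has_vector_derivative[OF bounded_bilinear_inner]
            smooth_curve_on_deriv(1) sm t)
    moreover have "((\<lambda>t. \<xi> t \<bullet> \<xi> t) has_vector_derivative 0) (at t within I)"
      by (rule has_vector_derivative_transform[OF t _ has_vector_derivative_const[of 1]])
         (use unit1 in \<open>simp add: norm_eq_1\<close>)
    ultimately have "\<xi> t \<bullet> deriv_on I \<xi> t + deriv_on I \<xi> t \<bullet> \<xi> t = 0"
      using vector_derivative_unique_within[OF nbt] by blast
    then have "\<xi> t \<bullet> deriv_on I \<xi> t = 0"
      by (simp add: inner_commute)
    then show ?thesis
      by (simp add: frenet2_def)
  qed
  have "deriv_on I \<xi> s \<noteq> 0"
    using K1 s by (auto simp: curvature1_def)
  then have "norm differentiable (at (deriv_on I \<xi> s) within deriv_on I \<xi> ` I)"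
    using differentiable_at_withinI differentiable_norm_at by blast
  then have "?K1 differentiable (at s within I)"
    unfolding curvature1_def[abs_def]
    using differentiable_chain_within[of "deriv_on I \<xi>" s I norm]
      differentiableI_vector[OF d1(2)]
    by (simp add: o_def)
  then have "?e2 differentiable (at s within I)"
    unfolding frenet2_def[abs_def]
    using K1 s differentiableI_vector[OF d1(2)]
    by (intro differentiable_scaleR differentiable_divide) auto
  then have d2: "(?e2 has_vector_derivative deriv_on I ?e2 s) (at s within I)"
    by (simp add: vector_derivative_works deriv_on_def)
  have "?e2 s \<bullet> deriv_on I ?e2 s + deriv_on I ?e2 s \<bullet> ?e2 s = 0"
    by (rule const[OF d2 d2, of 1]) (use unit2 in \<open>simp add: norm_eq_1\<close>)
  then have a2: "deriv_on I ?e2 s \<bullet> ?e2 s = 0"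
    by (simp add: inner_commute)
  have "\<xi> s \<bullet> deriv_on I ?e2 s + deriv_on I \<xi> s \<bullet> ?e2 s = 0"
    by (rule const[OF d1(1) d2, of 0]) (use orth in simp)
  then have a1: "deriv_on I ?e2 s \<bullet> \<xi> s = - ?K1 s"
    using unit2[OF s] by (simp add: xi'[OF s] inner_commute norm_eq_1)
  show e2': "deriv_on I ?e2 s = - ?K1 s *\<^sub>R \<xi> s + curvature2 I \<xi> s *\<^sub>R ?e3 s"
    using cross3_frame_expansion[OF unit1[OF s] unit2[OF s] orth[OF s], of "deriv_on I ?e2 s"]
    by (simp add: a1 a2 curvature2_def frenet3_def)
  have "bounded_bilinear cross3"
    using bilinear_cross bilinear_conv_bounded_bilinear by blast
  then have "((\<lambda>t. \<xi> t \<times> ?e2 t) has_vector_derivative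
               \<xi> s \<times> deriv_on I ?e2 s + deriv_on I \<xi> s \<times> ?e2 s) (at s within I)"
    by (rule bounded_bilinear.has_vector_derivative[OF _ d1(1) d2])
  moreover have "\<xi> s \<times> deriv_on I ?e2 s + deriv_on I \<xi> s \<times> ?e2 s =
                 - curvature2 I \<xi> s *\<^sub>R ?e2 s"
    using unit1[OF s] orth[OF s]
    by (simp add: e2' xi'[OF s] frenet3_def cross_add_right cross_mult_right cross_mult_left
          Cross3.right_diff_distrib
          Lagrange norm_eq_1)
  ultimately show "deriv_on I ?e3 s = - curvature2 I \<xi> s *\<^sub>R ?e2 s"
    unfolding frenet3_def[abs_def] by (intro deriv_on_eqI[OF I s]) simp
qed

end

theory Submission
  imports Defs
begin

text \<open>
  The principal normal \<open>\<xi>\<^sub>2\<close> can be eliminated from the equations of the alternative frame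
  \<open>\<xi>\<^sub>2' = p Y\<close>, \<open>Y' = - p \<xi>\<^sub>2 + q D\<close>, \<open>D' = - q Y\<close>. Differentiating the second equation once gives
  \<open>Y'' + (p\<^sup>2 + q\<^sup>2) Y = - p' \<xi>\<^sub>2 + q' D\<close>, so that this vector and \<open>Y'\<close> are two combinations of
  \<open>\<xi>\<^sub>2\<close> and \<open>D\<close> with determinant \<open>q p' - p q' \<noteq> 0\<close>. Cramer's rule yields
  \<open>\<xi>\<^sub>2 = \<lambda>\<^sub>1 Y'' - \<lambda>\<^sub>2 Y' + \<lambda>\<^sub>3 Y\<close>, and one more differentiation, with \<open>\<xi>\<^sub>2' = p Y\<close> on the left,
  is the asserted equation multiplied by \<open>\<lambda>\<^sub>1\<close>. Lemma \<open>rotating_frame_third_order_equation\<close> is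
  this argument, in which the frame equations are the only geometric input.

  It remains to derive the frame equations from the Frenet equations
  (\<open>alternative_frame_equations\<close>). Writing \<open>(K\<^sub>1, K\<^sub>2) = p (cos \<theta>, sin \<theta>)\<close>, the vectors \<open>Y\<close> and
  \<open>D\<close> arise from \<open>- \<xi>\<^sub>1\<close> and \<open>\<xi>\<^sub>3\<close> by a rotation through \<open>\<theta>\<close>, and \<open>q = \<theta>'\<close>; this is the content of
  \<open>normalized_curvature_derivatives\<close>. The derivatives occurring here exist because the class of
  smooth functions on an interval is closed under the operations that build the frame and its
  curvatures: bilinear products, reciprocals, and square roots of positive functions.
\<close>

section \<open>Smooth functions on an interval\<close>

lemma differentiable_has_vector_derivative_deriv_on:
  "f differentiable (at s within I) \<longleftrightarrow>
     (f has_vector_derivative deriv_on I f s) (at s within I)"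
  by (simp add: vector_derivative_works deriv_on_def)

lemma has_vector_derivative_cong_on:
  assumes "s \<in> I" "\<And>t. t \<in> I \<Longrightarrow> f t = g t"
  shows "(f has_vector_derivative d) (at s within I) \<longleftrightarrow>
         (g has_vector_derivative d) (at s within I)"
  using has_vector_derivative_transform[of s I f g d] has_vector_derivative_transform[of s I g f d]
    assms by auto

lemma deriv_on_cong:
  assumes "s \<in> I" "\<And>t. t \<in> I \<Longrightarrow> f t = g t"
  shows "deriv_on I f s = deriv_on I g s"
  by (simp add: deriv_on_def vector_derivative_def has_vector_derivative_cong_on[OF assms])

lemma differentiable_cong_on:
  fixes f g :: "real \<Rightarrow> 'a::real_normed_vector"
  assumes "s \<in> I" "\<And>t. t \<in> I \<Longrightarrow> f t = g t"
  shows "f differentiable (at s within I) \<longleftrightarrow> g differentiable (at s within I)"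
  by (simp add: differentiable_has_vector_derivative_deriv_on deriv_on_cong[OF assms]
      has_vector_derivative_cong_on[OF assms])

text \<open>Counting the available derivatives supplies an induction variable for the closure properties
  of smooth functions: the derivative of a product, reciprocal or square root is again composed of
  functions of the same kind, each differentiable to one order less.\<close>

definition differentiable_order :: "real set \<Rightarrow> nat \<Rightarrow> (real \<Rightarrow> 'a::real_normed_vector) \<Rightarrow> bool" where
  "differentiable_order I n f \<longleftrightarrow>
     (\<forall>k<n. \<forall>s\<in>I. (deriv_on I ^^ k) f differentiable (at s within I))"

lemma smooth_curve_on_iff_order: "smooth_curve_on I f \<longleftrightarrow> (\<forall>n. differentiable_order I n f)"
  unfolding smooth_curve_on_def differentiable_order_def by blast

lemma differentiable_order_0 [simp]: "differentiable_order I 0 f"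
  by (simp add: differentiable_order_def)

lemma differentiable_order_Suc:
  "differentiable_order I (Suc n) f \<longleftrightarrow>
     (\<forall>s\<in>I. f differentiable (at s within I)) \<and> differentiable_order I n (deriv_on I f)"
  unfolding differentiable_order_def All_less_Suc2 by (auto simp: funpow_swap1)

lemma differentiable_order_SucD: "differentiable_order I (Suc n) f \<Longrightarrow> differentiable_order I n f"
  by (simp add: differentiable_order_def)

lemma differentiable_order_cong:
  assumes "\<And>t. t \<in> I \<Longrightarrow> f t = g t"
  shows "differentiable_order I n f \<longleftrightarrow> differentiable_order I n g"
  using assms
proof (induction n arbitrary: f g)
  case (Suc n)
  have "differentiable_order I n (deriv_on I f) \<longleftrightarrow> differentiable_order I n (deriv_on I g)"
    by (rule Suc.IH) (use Suc.prems in \<open>auto intro: deriv_on_cong\<close>)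
  then show ?case
    using differentiable_cong_on[of _ I f g] Suc.prems by (auto simp: differentiable_order_Suc)
qed simp

lemma differentiable_order_SucI:
  assumes I: "proper_interval I"
    and d: "\<And>s. s \<in> I \<Longrightarrow> (f has_vector_derivative f' s) (at s within I)"
    and f': "differentiable_order I n f'"
  shows "differentiable_order I (Suc n) f"
proof -
  have "deriv_on I f s = f' s" if "s \<in> I" for s
    using deriv_on_eqI[OF I that d[OF that]] .
  then have "differentiable_order I n (deriv_on I f)"
    using f' differentiable_order_cong[of I "deriv_on I f" f' n] by simp
  then show ?thesis
    using d differentiableI_vector by (auto simp: differentiable_order_Suc)
qed

lemma differentiable_order_Suc_derivative:
  assumes "differentiable_order I (Suc n) f" "s \<in> I"
  shows "(f has_vector_derivative deriv_on I f s) (at s within I)"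
  using assms by (simp add: differentiable_order_Suc differentiable_has_vector_derivative_deriv_on)

context
  fixes I :: "real set"
  assumes I: "proper_interval I"
begin

lemma differentiable_order_const: "differentiable_order I n (\<lambda>_. c)"
proof (induction n arbitrary: c)
  case (Suc n)
  show ?case
    by (rule differentiable_order_SucI[OF I has_vector_derivative_const Suc.IH])
qed simp

lemma differentiable_order_add:
  assumes "differentiable_order I n f" "differentiable_order I n g"
  shows "differentiable_order I n (\<lambda>t. f t + g t)"
  using assms
proof (induction n arbitrary: f g)
  case (Suc n)
  show ?case
    by (rule differentiable_order_SucI[OF I
          has_vector_derivative_add[OF Suc.prems[THEN differentiable_order_Suc_derivative]]])
       (assumption | intro Suc.IH Suc.prems[unfolded differentiable_order_Suc, THEN conjunct2])+
qed simp

lemma differentiable_order_bilinear: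
  assumes B: "bounded_bilinear B"
    and "differentiable_order I n f" "differentiable_order I n g"
  shows "differentiable_order I n (\<lambda>t. B (f t) (g t))"
  using assms(2,3)
proof (induction n arbitrary: f g)
  case (Suc n)
  note d = Suc.prems[THEN differentiable_order_Suc_derivative]
    and o = Suc.prems[THEN differentiable_order_SucD]
    and o' = Suc.prems[unfolded differentiable_order_Suc, THEN conjunct2]
  show ?case
    by (rule differentiable_order_SucI[OF I bounded_bilinear.has_vector_derivative[OF B d]])
       (assumption | intro differentiable_order_add Suc.IH o o')+
qed simp

lemmas differentiable_order_mult = differentiable_order_bilinear[OF bounded_bilinear_mult]

text \<open>The derivative \<open>- f' / f\<^sup>2\<close> involves \<open>1 / f\<close> itself only to a lower order.\<close>

lemma differentiable_order_inverse:
  fixes f :: "real \<Rightarrow> real"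
  assumes "differentiable_order I n f" and nz: "\<And>s. s \<in> I \<Longrightarrow> f s \<noteq> 0"
  shows "differentiable_order I n (\<lambda>t. inverse (f t))"
  using assms(1)
proof (induction n)
  case (Suc n)
  note o = Suc.IH[OF differentiable_order_SucD[OF Suc.prems]]
    and o' = Suc.prems[unfolded differentiable_order_Suc, THEN conjunct2]
  have "((\<lambda>t. inverse (f t)) has_vector_derivative
          (- 1) * (deriv_on I f s * (inverse (f s) * inverse (f s)))) (at s within I)"
    if "s \<in> I" for s
    using DERIV_inverse_fun[of f "deriv_on I f s" s I]
      differentiable_order_Suc_derivative[OF Suc.prems that] nz[OF that]
    by (simp add: has_real_derivative_iff_has_vector_derivative mult_ac)
  then show ?case
    by (rule differentiable_order_SucI[OF I])
       (assumption | intro differentiable_order_mult differentiable_order_const o o')+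
qed simp

lemma differentiable_order_sqrt:
  fixes f :: "real \<Rightarrow> real"
  assumes "differentiable_order I n f" and pos: "\<And>s. s \<in> I \<Longrightarrow> 0 < f s"
  shows "differentiable_order I n (\<lambda>t. sqrt (f t))"
  using assms(1)
proof (induction n)
  case (Suc n)
  note o = Suc.IH[OF differentiable_order_SucD[OF Suc.prems]]
    and o' = Suc.prems[unfolded differentiable_order_Suc, THEN conjunct2]
  have inv: "differentiable_order I n (\<lambda>t. inverse (sqrt (f t)))"
    by (rule differentiable_order_inverse[OF o]) (use pos in force)
  have "((\<lambda>t. sqrt (f t)) has_vector_derivative
          (1 / 2) * (deriv_on I f s * inverse (sqrt (f s)))) (at s within I)"
    if "s \<in> I" for s
    using DERIV_chain2[where g = f and x = s and s = I, OF DERIV_real_sqrt[OF pos[OF that]]]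
      differentiable_order_Suc_derivative[OF Suc.prems that]
    by (simp add: has_real_derivative_iff_has_vector_derivative mult_ac)
  then show ?case
    by (rule differentiable_order_SucI[OF I])
       (assumption | intro differentiable_order_mult differentiable_order_const o' inv)+
qed simp

lemma smooth_curve_on_const: "smooth_curve_on I (\<lambda>_. c)"
  by (simp add: smooth_curve_on_iff_order differentiable_order_const)

lemma smooth_curve_on_add:
  "smooth_curve_on I f \<Longrightarrow> smooth_curve_on I g \<Longrightarrow> smooth_curve_on I (\<lambda>t. f t + g t)"
  by (simp add: smooth_curve_on_iff_order differentiable_order_add)

lemma smooth_curve_on_bilinear:
  "bounded_bilinear B \<Longrightarrow> smooth_curve_on I f \<Longrightarrow> smooth_curve_on I g \<Longrightarrow>
     smooth_curve_on I (\<lambda>t. B (f t) (g t))"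
  by (simp add: smooth_curve_on_iff_order differentiable_order_bilinear)

lemmas smooth_curve_on_mult = smooth_curve_on_bilinear[OF bounded_bilinear_mult]
lemmas smooth_curve_on_scaleR = smooth_curve_on_bilinear[OF bounded_bilinear_scaleR]
lemmas smooth_curve_on_inner = smooth_curve_on_bilinear[OF bounded_bilinear_inner]

lemma smooth_curve_on_cross3:
  "smooth_curve_on I f \<Longrightarrow> smooth_curve_on I g \<Longrightarrow> smooth_curve_on I (\<lambda>t. f t \<times> g t)"
  using smooth_curve_on_bilinear bilinear_cross bilinear_conv_bounded_bilinear by blast

lemma smooth_curve_on_diff:
  assumes "smooth_curve_on I f" "smooth_curve_on I g"
  shows "smooth_curve_on I (\<lambda>t. f t - g t)"
  using smooth_curve_on_add[OF assms(1) smooth_curve_on_scaleR[OF smooth_curve_on_const[of "-1"] assms(2)]]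
  by simp

lemma smooth_curve_on_power2:
  fixes f :: "real \<Rightarrow> real"
  shows "smooth_curve_on I f \<Longrightarrow> smooth_curve_on I (\<lambda>t. (f t)\<^sup>2)"
  by (simp add: power2_eq_square smooth_curve_on_mult)

lemma smooth_curve_on_divide:
  fixes f g :: "real \<Rightarrow> real"
  assumes "smooth_curve_on I f" "smooth_curve_on I g" "\<And>s. s \<in> I \<Longrightarrow> g s \<noteq> 0"
  shows "smooth_curve_on I (\<lambda>t. f t / g t)"
  using assms
  by (simp add: smooth_curve_on_iff_order divide_inverse differentiable_order_mult
      differentiable_order_inverse)

lemma smooth_curve_on_sqrt:
  fixes f :: "real \<Rightarrow> real"
  assumes "smooth_curve_on I f" "\<And>s. s \<in> I \<Longrightarrow> 0 < f s"
  shows "smooth_curve_on I (\<lambda>t. sqrt (f t))"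
  using assms by (simp add: smooth_curve_on_iff_order differentiable_order_sqrt)

end

lemma smooth_curve_on_deriv_on: "smooth_curve_on I f \<Longrightarrow> smooth_curve_on I (deriv_on I f)"
  by (meson smooth_curve_on_iff_order differentiable_order_Suc)

lemma smooth_curve_on_cong:
  assumes "\<And>t. t \<in> I \<Longrightarrow> f t = g t"
  shows "smooth_curve_on I f \<longleftrightarrow> smooth_curve_on I g"
  using differentiable_order_cong[of I f g] assms by (simp add: smooth_curve_on_iff_order)

lemmas smooth_curve_on_intros =
  smooth_curve_on_const smooth_curve_on_add smooth_curve_on_diff smooth_curve_on_mult
  smooth_curve_on_scaleR smooth_curve_on_inner smooth_curve_on_cross3 smooth_curve_on_power2
  smooth_curve_on_divide smooth_curve_on_sqrt smooth_curve_on_deriv_on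

section \<open>Smoothness of the Frenet-type apparatus\<close>

context
  fixes I :: "real set" and \<xi> :: "real \<Rightarrow> real^3"
  assumes I: "proper_interval I" and xi: "versor_field I \<xi>"
    and K1: "\<And>s. s \<in> I \<Longrightarrow> curvature1 I \<xi> s > 0"
begin

lemma smooth_versor: "smooth_curve_on I \<xi>"
  using xi by (simp add: versor_field_def)

lemma smooth_curvature1: "smooth_curve_on I (curvature1 I \<xi>)"
proof -
  have "curvature1 I \<xi> = (\<lambda>s. sqrt (deriv_on I \<xi> s \<bullet> deriv_on I \<xi> s))"
    by (simp add: fun_eq_iff curvature1_def norm_eq_sqrt_inner)
  then show ?thesis
    using K1 by (auto intro!: smooth_curve_on_intros I smooth_versor)
qed

lemma smooth_frenet2: "smooth_curve_on I (frenet2 I \<xi>)"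
  unfolding frenet2_def[abs_def]
  using K1 by (fastforce intro!: smooth_curve_on_intros I smooth_versor smooth_curvature1)

lemma smooth_frenet3: "smooth_curve_on I (frenet3 I \<xi>)"
  unfolding frenet3_def[abs_def]
  by (intro smooth_curve_on_intros I smooth_versor smooth_frenet2)

lemma smooth_curvature2: "smooth_curve_on I (curvature2 I \<xi>)"
  unfolding curvature2_def[abs_def]
  by (intro smooth_curve_on_intros I smooth_frenet2 smooth_frenet3)

lemma sum_squares_curvature_pos:
  assumes "s \<in> I" shows "(curvature1 I \<xi> s)\<^sup>2 + (curvature2 I \<xi> s)\<^sup>2 > 0"
  using K1[OF assms] by (simp add: add_pos_nonneg)

lemma af_p_pos: "s \<in> I \<Longrightarrow> af_p I \<xi> s > 0"
  using sum_squares_curvature_pos by (simp add: af_p_def)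

lemma af_p_squared: "(af_p I \<xi> s)\<^sup>2 = (curvature1 I \<xi> s)\<^sup>2 + (curvature2 I \<xi> s)\<^sup>2"
  by (simp add: af_p_def)

lemma smooth_af_p: "smooth_curve_on I (af_p I \<xi>)"
  unfolding af_p_def[abs_def]
  by (intro smooth_curve_on_intros I smooth_curvature1 smooth_curvature2 sum_squares_curvature_pos)

lemma smooth_af_q: "smooth_curve_on I (af_q I \<xi>)"
  unfolding af_q_def[abs_def]
  using K1 sum_squares_curvature_pos
  by (fastforce intro!: smooth_curve_on_intros I smooth_curvature1 smooth_curvature2)

section \<open>The equations of the alternative frame\<close>

lemma versor_orthogonal_frenet2:
  assumes s: "s \<in> I" shows "\<xi> s \<bullet> frenet2 I \<xi> s = 0"
proof -
  note d = smooth_curve_on_deriv(1)[OF smooth_versor s]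
  have "((\<lambda>t. \<xi> t \<bullet> \<xi> t) has_vector_derivative \<xi> s \<bullet> deriv_on I \<xi> s + deriv_on I \<xi> s \<bullet> \<xi> s)
          (at s within I)"
    by (rule bounded_bilinear.has_vector_derivative[OF bounded_bilinear_inner d d])
  moreover have "((\<lambda>t. \<xi> t \<bullet> \<xi> t) has_vector_derivative 0) (at s within I)"
    by (rule has_vector_derivative_transform[OF s _ has_vector_derivative_const[of 1]])
       (use xi in \<open>simp add: versor_field_def norm_eq_1\<close>)
  ultimately have "\<xi> s \<bullet> deriv_on I \<xi> s = 0"
    using vector_derivative_unique_within[OF proper_interval_not_bot[OF I s]]
    by (force simp: inner_commute)
  then show ?thesis
    by (simp add: frenet2_def)
qed

text \<open>Pythagoras' theorem, as \<open>- K\<^sub>1\<close> and \<open>K\<^sub>2\<close> are the coordinates of \<open>\<xi>\<^sub>2'\<close> with respect to the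
  orthonormal pair \<open>\<xi>\<^sub>1, \<xi>\<^sub>3\<close>.\<close>

lemma norm_deriv_frenet2:
  assumes s: "s \<in> I" shows "norm (deriv_on I (frenet2 I \<xi>) s) = af_p I \<xi> s"
proof -
  have n1: "\<xi> s \<bullet> \<xi> s = 1"
    using xi s by (simp add: versor_field_def norm_eq_1)
  have "norm (frenet2 I \<xi> s) = 1"
    using K1[OF s] by (auto simp: frenet2_def curvature1_def)
  then have n2: "frenet2 I \<xi> s \<bullet> frenet2 I \<xi> s = 1"
    by (simp add: norm_eq_1)
  have n3: "frenet3 I \<xi> s \<bullet> frenet3 I \<xi> s = 1" and o: "\<xi> s \<bullet> frenet3 I \<xi> s = 0"
    using versor_orthogonal_frenet2[OF s] n1 n2
    by (simp_all add: frenet3_def dot_cross dot_cross_self)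
  have "deriv_on I (frenet2 I \<xi>) s =
          - curvature1 I \<xi> s *\<^sub>R \<xi> s + curvature2 I \<xi> s *\<^sub>R frenet3 I \<xi> s"
    using frenet_equations(2)[OF I xi _ s] K1 by blast
  then show ?thesis
    by (simp add: norm_eq_sqrt_inner af_p_def inner_diff_left inner_diff_right inner_add_left
        inner_add_right n1 n3 o inner_commute[of "frenet3 I \<xi> s" "\<xi> s"] power2_eq_square)
qed

text \<open>This is the binormal \<open>af_D\<close>, in the coordinates that make its derivative computable
  from the Frenet equations.\<close>

definition rotated_binormal :: "real \<Rightarrow> real^3" where
  "rotated_binormal s = (curvature2 I \<xi> s / af_p I \<xi> s) *\<^sub>R \<xi> s
     + (curvature1 I \<xi> s / af_p I \<xi> s) *\<^sub>R frenet3 I \<xi> s"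

lemma af_Y_eq:
  assumes s: "s \<in> I"
  shows "af_Y I \<xi> s = - (curvature1 I \<xi> s / af_p I \<xi> s) *\<^sub>R \<xi> s
     + (curvature2 I \<xi> s / af_p I \<xi> s) *\<^sub>R frenet3 I \<xi> s"
proof -
  have "deriv_on I (frenet2 I \<xi>) s =
          - curvature1 I \<xi> s *\<^sub>R \<xi> s + curvature2 I \<xi> s *\<^sub>R frenet3 I \<xi> s"
    using frenet_equations(2)[OF I xi _ s] K1 by blast
  then show ?thesis
    unfolding af_Y_def norm_deriv_frenet2[OF s]
    by (simp add: scaleR_right_diff_distrib scaleR_add_right)
qed

text \<open>With \<open>K\<^sub>1 / p = cos \<theta>\<close> and \<open>K\<^sub>2 / p = sin \<theta>\<close> these are \<open>(cos \<theta>)' = - \<theta>' sin \<theta>\<close> and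
  \<open>(sin \<theta>)' = \<theta>' cos \<theta>\<close>, because \<open>q = (tan \<theta>)' cos\<^sup>2 \<theta>\<close> is \<open>\<theta>'\<close>.\<close>

lemma normalized_curvature_derivatives:
  assumes s: "s \<in> I"
  defines "c \<equiv> curvature1 I \<xi> s / af_p I \<xi> s" and "d \<equiv> curvature2 I \<xi> s / af_p I \<xi> s"
  shows "((\<lambda>t. curvature1 I \<xi> t / af_p I \<xi> t) has_vector_derivative - (af_q I \<xi> s * d)) (at s within I)"
    and "((\<lambda>t. curvature2 I \<xi> t / af_p I \<xi> t) has_vector_derivative af_q I \<xi> s * c) (at s within I)"
proof -
  define k l p where "k = curvature1 I \<xi> s" and "l = curvature2 I \<xi> s" and "p = af_p I \<xi> s"
  define k' l' p' where "k' = deriv_on I (curvature1 I \<xi>) s"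
    and "l' = deriv_on I (curvature2 I \<xi>) s" and "p' = deriv_on I (af_p I \<xi>) s"
  have dk: "(curvature1 I \<xi> has_real_derivative k') (at s within I)"
    and dl: "(curvature2 I \<xi> has_real_derivative l') (at s within I)"
    and dp: "(af_p I \<xi> has_real_derivative p') (at s within I)"
    unfolding k'_def l'_def p'_def has_real_derivative_iff_has_vector_derivative
    by (rule smooth_curve_on_deriv(1)[OF _ s], rule smooth_curvature1 smooth_curvature2 smooth_af_p)+
  have pos: "k > 0" "p > 0"
    using K1 af_p_pos s by (simp_all add: k_def p_def)
  have pp: "p * p = k * k + l * l"
    using af_p_squared[of s] by (simp add: k_def l_def p_def power2_eq_square)
  have "((\<lambda>t. af_p I \<xi> t * af_p I \<xi> t) has_real_derivative p' * p + p' * p) (at s within I)"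
    using DERIV_mult[OF dp dp] by (simp add: p_def)
  moreover have "((\<lambda>t. af_p I \<xi> t * af_p I \<xi> t) has_real_derivative
      (k' * k + k' * k) + (l' * l + l' * l)) (at s within I)"
    using DERIV_add[OF DERIV_mult[OF dk dk] DERIV_mult[OF dl dl]] af_p_squared
    by (simp add: k_def l_def power2_eq_square)
  ultimately have pp': "p' * p = k' * k + l' * l"
    using vector_derivative_unique_within[OF proper_interval_not_bot[OF I s]]
    by (force simp: has_real_derivative_iff_has_vector_derivative)
  have "deriv_on I (\<lambda>t. curvature2 I \<xi> t / curvature1 I \<xi> t) s = (l' * k - l * k') / (k * k)"
    using DERIV_divide[OF dl dk] pos unfolding k_def l_def
    by (intro deriv_on_eqI[OF I s]) (simp add: has_real_derivative_iff_has_vector_derivative)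
  then have q: "af_q I \<xi> s = (l' * k - l * k') / (p * p)"
    using pos by (simp add: af_q_def k_def[symmetric] l_def[symmetric] pp power2_eq_square)
  have "(k' * p - k * p') * p = - ((l' * k - l * k') * l)"
  proof -
    have "(k' * p - k * p') * p = k' * (p * p) - k * (p' * p)"
      by (simp add: algebra_simps)
    then show ?thesis
      unfolding pp pp' by (simp add: algebra_simps)
  qed
  moreover have "(k' * p - k * p') / (p * p) = ((k' * p - k * p') * p) / (p * p * p)"
    using pos by simp
  ultimately have "(k' * p - k * p') / (p * p) = - (af_q I \<xi> s * d)"
    by (simp only: q d_def l_def[symmetric] p_def[symmetric]) simp
  then show "((\<lambda>t. curvature1 I \<xi> t / af_p I \<xi> t) has_vector_derivative - (af_q I \<xi> s * d)) (at s within I)"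
    using DERIV_divide[OF dk dp] pos
    by (simp add: has_real_derivative_iff_has_vector_derivative k_def p_def)
  have "(l' * p - l * p') * p = (l' * k - l * k') * k"
  proof -
    have "(l' * p - l * p') * p = l' * (p * p) - l * (p' * p)"
      by (simp add: algebra_simps)
    then show ?thesis
      unfolding pp pp' by (simp add: algebra_simps)
  qed
  moreover have "(l' * p - l * p') / (p * p) = ((l' * p - l * p') * p) / (p * p * p)"
    using pos by simp
  ultimately have "(l' * p - l * p') / (p * p) = af_q I \<xi> s * c"
    by (simp only: q c_def k_def[symmetric] p_def[symmetric]) simp
  then show "((\<lambda>t. curvature2 I \<xi> t / af_p I \<xi> t) has_vector_derivative af_q I \<xi> s * c) (at s within I)"
    using DERIV_divide[OF dl dp] pos
    by (simp add: has_real_derivative_iff_has_vector_derivative l_def p_def)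
qed

lemma alternative_frame_equations:
  assumes s: "s \<in> I"
  shows "(frenet2 I \<xi> has_vector_derivative af_p I \<xi> s *\<^sub>R af_Y I \<xi> s) (at s within I)"
    and "(af_Y I \<xi> has_vector_derivative
            - af_p I \<xi> s *\<^sub>R frenet2 I \<xi> s + af_q I \<xi> s *\<^sub>R rotated_binormal s) (at s within I)"
    and "(rotated_binormal has_vector_derivative - af_q I \<xi> s *\<^sub>R af_Y I \<xi> s) (at s within I)"
proof -
  let ?K1 = "curvature1 I \<xi> s" and ?K2 = "curvature2 I \<xi> s" and ?p = "af_p I \<xi> s"
  have p: "?p > 0" and pp: "?p * ?p = ?K1 * ?K1 + ?K2 * ?K2"
    using af_p_pos[OF s] af_p_squared[of s] by (simp_all add: power2_eq_square)
  show "(frenet2 I \<xi> has_vector_derivative ?p *\<^sub>R af_Y I \<xi> s) (at s within I)"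
    using smooth_curve_on_deriv(1)[OF smooth_frenet2 s] p
    by (simp add: af_Y_def norm_deriv_frenet2[OF s])
  have K1': "\<forall>s\<in>I. curvature1 I \<xi> s > 0"
    using K1 by blast
  have d1: "(\<xi> has_vector_derivative ?K1 *\<^sub>R frenet2 I \<xi> s) (at s within I)"
    and d3: "(frenet3 I \<xi> has_vector_derivative - ?K2 *\<^sub>R frenet2 I \<xi> s) (at s within I)"
    using smooth_curve_on_deriv(1)[OF smooth_versor s] smooth_curve_on_deriv(1)[OF smooth_frenet3 s]
    unfolding frenet_equations[OF I xi K1' s] .
  note dc = normalized_curvature_derivatives[OF s]
  note scale = bounded_bilinear.has_vector_derivative[OF bounded_bilinear_scaleR]
  \<comment> \<open>The two Frenet contributions along \<open>\<xi>\<^sub>2\<close> in \<open>Y'\<close> add up to \<open>- p\<close>; those in \<open>D'\<close> cancel.\<close>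
  have coeff: "- ?p = - (?K1 / ?p) * ?K1 - ?K2 / ?p * ?K2"
    using p pp by (simp add: field_simps)
  show "(af_Y I \<xi> has_vector_derivative
            - ?p *\<^sub>R frenet2 I \<xi> s + af_q I \<xi> s *\<^sub>R rotated_binormal s) (at s within I)"
    unfolding coeff
    by (rule has_vector_derivative_cong_on[THEN iffD2, OF s af_Y_eq], assumption,
        rule has_vector_derivative_eq_rhs[OF has_vector_derivative_add[OF
          scale[OF has_vector_derivative_minus[OF dc(1)] d1] scale[OF dc(2) d3]]])
       (simp add: rotated_binormal_def algebra_simps)
  show "(rotated_binormal has_vector_derivative - af_q I \<xi> s *\<^sub>R af_Y I \<xi> s) (at s within I)"
    unfolding rotated_binormal_def[abs_def] af_Y_eq[OF s]
    by (rule has_vector_derivative_eq_rhs[OF has_vector_derivative_add[OF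
          scale[OF dc(2) d1] scale[OF dc(1) d3]]])
       (simp add: algebra_simps)
qed

end

section \<open>Elimination of the frame\<close>

text \<open>Solving \<open>Y'\<close> and \<open>Y''\<close> for \<open>N\<close> by Cramer's rule gives \<open>N = l1 Y'' - l2 Y' + l3 Y\<close>; the
  equation is the derivative of this identity. The formula for \<open>l2\<close> is \<open>q' / (q' p - q p')\<close>
  in disguise.\<close>

lemma rotating_frame_third_order_equation:
  fixes N Y D :: "real \<Rightarrow> 'a::real_normed_vector" and p q l1 l2 l3 :: "real \<Rightarrow> real"
  assumes I: "proper_interval I"
    and p: "smooth_curve_on I p" and q: "smooth_curve_on I q"
    and N': "\<And>s. s \<in> I \<Longrightarrow> (N has_vector_derivative p s *\<^sub>R Y s) (at s within I)"
    and Y': "\<And>s. s \<in> I \<Longrightarrow>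
          (Y has_vector_derivative - p s *\<^sub>R N s + q s *\<^sub>R D s) (at s within I)"
    and D': "\<And>s. s \<in> I \<Longrightarrow> (D has_vector_derivative - q s *\<^sub>R Y s) (at s within I)"
    and pq: "\<And>s. s \<in> I \<Longrightarrow> p s \<noteq> 0 \<and> q s \<noteq> 0"
    and det: "\<And>s. s \<in> I \<Longrightarrow> deriv_on I q s * p s - q s * deriv_on I p s \<noteq> 0"
    and l1: "\<And>s. s \<in> I \<Longrightarrow> l1 s = q s / (deriv_on I q s * p s - q s * deriv_on I p s)"
    and l2: "\<And>s. s \<in> I \<Longrightarrow> l2 s = 1 / p s * (1 + deriv_on I p s * l1 s)"
    and l3: "\<And>s. s \<in> I \<Longrightarrow> l3 s = ((p s)\<^sup>2 + (q s)\<^sup>2) * l1 s"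
    and s: "s \<in> I"
  shows "(deriv_on I ^^ 3) Y s
      + (1 / l1 s * (deriv_on I l1 s - l2 s)) *\<^sub>R (deriv_on I ^^ 2) Y s
      + (1 / l1 s * (l3 s - deriv_on I l2 s)) *\<^sub>R deriv_on I Y s
      + (1 / l1 s * (deriv_on I l3 s - p s)) *\<^sub>R Y s = 0"
proof -
  let ?Y1 = "deriv_on I Y" and ?Y2 = "deriv_on I (deriv_on I Y)"
  let ?p' = "deriv_on I p" and ?q' = "deriv_on I q"
  note scale = bounded_bilinear.has_vector_derivative[OF bounded_bilinear_scaleR]
  note smooth_deriv = smooth_curve_on_deriv(1)

  have Y1: "?Y1 t = - p t *\<^sub>R N t + q t *\<^sub>R D t" if "t \<in> I" for t
    using deriv_on_eqI[OF I that Y'[OF that]] .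
  have dY1: "(?Y1 has_vector_derivative
      - ?p' t *\<^sub>R N t + ?q' t *\<^sub>R D t - ((p t)\<^sup>2 + (q t)\<^sup>2) *\<^sub>R Y t) (at t within I)"
    if t: "t \<in> I" for t
    by (rule has_vector_derivative_cong_on[THEN iffD2, OF t Y1], assumption,
        rule has_vector_derivative_eq_rhs[OF has_vector_derivative_add[OF
          scale[OF has_vector_derivative_minus[OF smooth_deriv[OF p t]] N'[OF t]]
          scale[OF smooth_deriv[OF q t] D'[OF t]]]])
       (simp add: algebra_simps power2_eq_square)
  have Y2: "?Y2 t = - ?p' t *\<^sub>R N t + ?q' t *\<^sub>R D t - ((p t)\<^sup>2 + (q t)\<^sup>2) *\<^sub>R Y t"
    if "t \<in> I" for t
    using deriv_on_eqI[OF I that dY1[OF that]] .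

  have N_eq: "N t = l1 t *\<^sub>R ?Y2 t - l2 t *\<^sub>R ?Y1 t + l3 t *\<^sub>R Y t" if t: "t \<in> I" for t
  proof -
    define \<Delta> where "\<Delta> = ?q' t * p t - q t * ?p' t"
    have nz: "\<Delta> \<noteq> 0" "p t \<noteq> 0"
      using det pq t by (auto simp: \<Delta>_def)
    have a1: "l1 t = q t / \<Delta>"
      using l1[OF t] by (simp add: \<Delta>_def)
    have a2: "l2 t = ?q' t / \<Delta>"
      using nz by (simp add: l2[OF t] a1 field_simps) (simp add: \<Delta>_def algebra_simps)
    have cN: "l2 t * p t - l1 t * ?p' t = 1"
      using nz unfolding a1 a2 by (simp add: field_simps) (simp add: \<Delta>_def algebra_simps)
    have cD: "l1 t * ?q' t - l2 t * q t = 0"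
      unfolding a1 a2 by simp
    have "l1 t *\<^sub>R ?Y2 t - l2 t *\<^sub>R ?Y1 t + l3 t *\<^sub>R Y t =
        (l2 t * p t - l1 t * ?p' t) *\<^sub>R N t + (l1 t * ?q' t - l2 t * q t) *\<^sub>R D t
        + (l3 t - ((p t)\<^sup>2 + (q t)\<^sup>2) * l1 t) *\<^sub>R Y t"
      unfolding Y1[OF t] Y2[OF t] by (simp add: algebra_simps)
    then show ?thesis
      by (simp add: cN cD l3[OF t])
  qed

  have sl1: "smooth_curve_on I l1"
    by (rule smooth_curve_on_cong[THEN iffD2, OF l1], assumption)
       (intro smooth_curve_on_intros I p q det)
  have sl2: "smooth_curve_on I l2"
    by (rule smooth_curve_on_cong[THEN iffD2, OF l2], assumption)
       (use pq in \<open>auto intro!: smooth_curve_on_intros I p sl1\<close>)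
  have sl3: "smooth_curve_on I l3"
    by (rule smooth_curve_on_cong[THEN iffD2, OF l3], assumption)
       (intro smooth_curve_on_intros I p q sl1)
  have dY: "(Y has_vector_derivative ?Y1 s) (at s within I)"
    using Y'[OF s] Y1[OF s] by simp
  have dY1': "(?Y1 has_vector_derivative ?Y2 s) (at s within I)"
    using dY1[OF s] Y2[OF s] by simp
  have "?Y2 differentiable (at s within I)"
    by (rule differentiable_cong_on[THEN iffD2, OF s Y2], assumption)
       (intro differentiable_add differentiable_diff differentiable_scaleR differentiable_minus
         differentiable_power differentiableI_vector[OF smooth_deriv[OF _ s]]
         differentiableI_vector[OF N'[OF s]] differentiableI_vector[OF D'[OF s]]
         differentiableI_vector[OF dY] smooth_curve_on_deriv_on p q)
  then have dY2: "(?Y2 has_vector_derivative deriv_on I ?Y2 s) (at s within I)"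
    by (simp add: differentiable_has_vector_derivative_deriv_on)
  have "(N has_vector_derivative
      (l1 s *\<^sub>R deriv_on I ?Y2 s + deriv_on I l1 s *\<^sub>R ?Y2 s)
      - (l2 s *\<^sub>R ?Y2 s + deriv_on I l2 s *\<^sub>R ?Y1 s)
      + (l3 s *\<^sub>R ?Y1 s + deriv_on I l3 s *\<^sub>R Y s)) (at s within I)"
    by (rule has_vector_derivative_cong_on[THEN iffD2, OF s N_eq], assumption)
       (intro has_vector_derivative_add has_vector_derivative_diff scale
        smooth_deriv sl1 sl2 sl3 s dY dY1' dY2)
  then have "p s *\<^sub>R Y s = (l1 s *\<^sub>R deriv_on I ?Y2 s + deriv_on I l1 s *\<^sub>R ?Y2 s)
      - (l2 s *\<^sub>R ?Y2 s + deriv_on I l2 s *\<^sub>R ?Y1 s)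
      + (l3 s *\<^sub>R ?Y1 s + deriv_on I l3 s *\<^sub>R Y s)"
    by (rule vector_derivative_unique_within[OF proper_interval_not_bot[OF I s] N'[OF s]])
  then have "l1 s *\<^sub>R deriv_on I ?Y2 s + (deriv_on I l1 s - l2 s) *\<^sub>R ?Y2 s
      + (l3 s - deriv_on I l2 s) *\<^sub>R ?Y1 s + (deriv_on I l3 s - p s) *\<^sub>R Y s = 0"
    by (simp add: algebra_simps)
  then have "(1 / l1 s) *\<^sub>R (l1 s *\<^sub>R deriv_on I ?Y2 s + (deriv_on I l1 s - l2 s) *\<^sub>R ?Y2 s
      + (l3 s - deriv_on I l2 s) *\<^sub>R ?Y1 s + (deriv_on I l3 s - p s) *\<^sub>R Y s) = 0"
    by simp
  moreover have "l1 s \<noteq> 0"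
    using l1 det pq s by simp
  ultimately show ?thesis
    by (simp add: scaleR_add_right numeral_3_eq_3 numeral_2_eq_2)
qed

theorem theorem15:
  fixes I :: "real set"
    and r \<xi> Y :: "real \<Rightarrow> real^3"
    and \<pi> :: "real \<Rightarrow> (real^3) set"
    and p q lambda1 lambda2 lambda3 :: "real \<Rightarrow> real"
  assumes "myller_configuration I r \<xi> \<pi>"
    and "\<forall>s\<in>I. curvature1 I \<xi> s > 0"
    and "Y = af_Y I \<xi>" and "p = af_p I \<xi>" and "q = af_q I \<xi>"
    and "\<forall>s\<in>I. p s \<noteq> 0 \<and> q s \<noteq> 0"
    and "\<forall>s\<in>I. deriv_on I q s * p s - q s * deriv_on I p s \<noteq> 0"
    and "\<forall>s\<in>I. lambda1 s = q s / (deriv_on I q s * p s - q s * deriv_on I p s)"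
    and "\<forall>s\<in>I. lambda2 s = 1 / p s * (1 + deriv_on I p s * lambda1 s)"
    and "\<forall>s\<in>I. lambda3 s = ((p s)\<^sup>2 + (q s)\<^sup>2) * lambda1 s"
  shows "\<forall>s\<in>I.
      (deriv_on I ^^ 3) Y s
      + (1 / lambda1 s * (deriv_on I lambda1 s - lambda2 s)) *\<^sub>R (deriv_on I ^^ 2) Y s
      + (1 / lambda1 s * (lambda3 s - deriv_on I lambda2 s)) *\<^sub>R deriv_on I Y s
      + (1 / lambda1 s * (deriv_on I lambda3 s - p s)) *\<^sub>R Y s = 0"
proof
  fix s assume s: "s \<in> I"
  have I: "proper_interval I" and xi: "versor_field I \<xi>"
    using assms(1) by (simp_all add: myller_configuration_def)
  have K1: "\<And>s. s \<in> I \<Longrightarrow> curvature1 I \<xi> s > 0"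
    using assms(2) by blast
  note frame = alternative_frame_equations[OF I xi K1]
  show "(deriv_on I ^^ 3) Y s
      + (1 / lambda1 s * (deriv_on I lambda1 s - lambda2 s)) *\<^sub>R (deriv_on I ^^ 2) Y s
      + (1 / lambda1 s * (lambda3 s - deriv_on I lambda2 s)) *\<^sub>R deriv_on I Y s
      + (1 / lambda1 s * (deriv_on I lambda3 s - p s)) *\<^sub>R Y s = 0"
    by (rule rotating_frame_third_order_equation[OF I, where N = "frenet2 I \<xi>" and q = q
          and D = "rotated_binormal I \<xi>"])
       (use s assms(6-10) smooth_af_p[OF I xi K1] smooth_af_q[OF I xi K1] frame
         in \<open>auto simp: assms(3-5)\<close>)
qed

end
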